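(* Let $h:\mathbb{R}^n\to\mathbb{R}\cup\{\pm\infty\}$ be a proper function and let $\overline{x}\in\mathbb{R}^n$. Then the following are equivalent: (i) $\overline{x}\in\operatorname{argmin}_{\mathbb{R}^n}h$ and $h$ is star quasiconvex with respect to $\overline{x}$; (ii) for every $\delta\in\mathbb{R}$ such that $S_\delta(h)\neq\emptyset$, the sublevel set $S_\delta(h)$ is star-shaped at $\overline{x}$.
   Context: $h$ is proper if $\operatorname{dom}h:=\{x\in\mathbb{R}^n: h(x)<+\infty\}$ is nonempty and $h(x)>-\infty$ for all $x$. $\operatorname{argmin}_{\mathbb{R}^n}h$ is the set of global minimizers of $h$. For $\delta\in\mathbb{R}$, $S_\delta(h):=\{x\in\mathbb{R}^n: h(x)\le\delta\}$. A nonempty set $K\subseteq\mathbb{R}^n$ is star-shaped at $x_0$ if $x_0\in K$ and for every $x\in K$ the segment $[x_0,x]$ is contained in $K$. For $\overline{x}\in\operatorname{argmin}_{\mathbb{R}^n}h$, $h$ is star quasiconvex with respect to $\overline{x}$ if $h(\lambda\overline{x}+(1-\lambda)y)\le h(y)$ for every $y\in\operatorname{dom}h$ and every $\lambda\in[0,1]$. *)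

theory Defs
  imports "HOL-Analysis.Analysis"
begin

definition effective_domain :: "('a \<Rightarrow> ereal) \<Rightarrow> 'a set" where
  "effective_domain h = {x. h x < \<infinity>}"

definition proper_function :: "('a \<Rightarrow> ereal) \<Rightarrow> bool" where
  "proper_function h \<longleftrightarrow> effective_domain h \<noteq> {} \<and> (\<forall>x. h x > -\<infinity>)"

definition argmin_set :: "('a \<Rightarrow> ereal) \<Rightarrow> 'a set" where
  "argmin_set h = {x. is_arg_min h (\<lambda>_. True) x}"

definition sublevel_set :: "real \<Rightarrow> ('a \<Rightarrow> ereal) \<Rightarrow> 'a set" where
  "sublevel_set \<delta> h = {x. h x \<le> ereal \<delta>}"

definition star_shaped_at :: "'a::real_vector set \<Rightarrow> 'a \<Rightarrow> bool" where
  "star_shaped_at K x0 \<longleftrightarrow> K \<noteq> {} \<and> x0 \<in> K \<and> (\<forall>x\<in>K. closed_segment x0 x \<subseteq> K)"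

text \<open>
  Star quasiconvexity with respect to a point is only meant for points of \<open>argmin_set h\<close>;
  the definition does not include this requirement, so it has to be stated alongside.
\<close>
definition star_quasiconvex_wrt :: "('a::real_vector \<Rightarrow> ereal) \<Rightarrow> 'a \<Rightarrow> bool" where
  "star_quasiconvex_wrt h xbar \<longleftrightarrow>
     (\<forall>y\<in>effective_domain h. \<forall>t\<in>{0..1::real}. h (t *\<^sub>R xbar + (1 - t) *\<^sub>R y) \<le> h y)"

end

theory Submission
  imports Defs
begin

text \<open>Both sides amount to one inequality: \<open>h z \<le> h y\<close> for every
  \<open>y\<close> in the effective domain and every \<open>z\<close> on the segment from
  \<open>xbar\<close> to \<open>y\<close>. Given it, a sublevel set that contains \<open>y\<close>
  contains the whole segment; minimality puts \<open>xbar\<close> in every nonempty sublevel set.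
  Conversely, star-shapedness of the sublevel set at level \<open>h y\<close> is this inequality for
  that \<open>y\<close>. The level must be real, which is where \<open>proper_function_ereal\<close>
  enters.\<close>

lemma proper_function_ereal:
  assumes "proper_function h" and "y \<in> effective_domain h"
  obtains r :: real where "h y = ereal r"
  using assms by (cases "h y") (auto simp: proper_function_def effective_domain_def dest: spec[of _ y])

lemma mem_argmin_set_iff: "x \<in> argmin_set h \<longleftrightarrow> (\<forall>y. h x \<le> h y)"
  by (simp add: argmin_set_def is_arg_min_linorder)

theorem theorem9:
  fixes h :: "real ^ 'n \<Rightarrow> ereal" and xbar :: "real ^ 'n"
  assumes "proper_function h"
  shows "(xbar \<in> argmin_set h \<and> star_quasiconvex_wrt h xbar) \<longleftrightarrow>
    (\<forall>\<delta>::real. sublevel_set \<delta> h \<noteq> {} \<longrightarrow> star_shaped_at (sublevel_set \<delta> h) xbar)"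
    (is "?min \<and> ?qc \<longleftrightarrow> ?star")
proof (intro iffI conjI allI impI)
  fix \<delta> :: real
  assume L: "?min \<and> ?qc" and ne: "sublevel_set \<delta> h \<noteq> {}"
  have "xbar \<in> sublevel_set \<delta> h"
    using L ne by (auto simp: mem_argmin_set_iff sublevel_set_def intro: order_trans)
  moreover have "closed_segment xbar y \<subseteq> sublevel_set \<delta> h" if y: "y \<in> sublevel_set \<delta> h" for y
  proof
    fix z
    assume "z \<in> closed_segment xbar y"
    \<comment> \<open>\<open>closed_segment\<close> puts its parameter on the second endpoint,
      whereas star quasiconvexity puts \<open>t\<close> on \<open>xbar\<close>; swapping the
      endpoints aligns the two.\<close>
    then obtain t where t: "t \<in> {0..1}" and z: "z = t *\<^sub>R xbar + (1 - t) *\<^sub>R y"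
      unfolding closed_segment_commute[of xbar y] by (auto simp: closed_segment_def add.commute)
    have "y \<in> effective_domain h"
      using y by (auto simp: sublevel_set_def effective_domain_def intro: le_less_trans)
    then have "h z \<le> h y"
      using L t z by (auto simp: star_quasiconvex_wrt_def)
    then show "z \<in> sublevel_set \<delta> h"
      using y by (auto simp: sublevel_set_def)
  qed
  ultimately show "star_shaped_at (sublevel_set \<delta> h) xbar"
    using ne by (simp add: star_shaped_at_def)
next
  assume R: ?star
  \<comment> \<open>This inequality yields both goals: the endpoint \<open>z = xbar\<close> gives
    minimality, a general \<open>z\<close> gives star quasiconvexity.\<close>
  have seg: "h z \<le> h y" if y: "y \<in> effective_domain h" and z: "z \<in> closed_segment xbar y" for y z
  proof -
    \<comment> \<open>The level is the value at \<open>y\<close> itself, the least one whose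
      sublevel set contains \<open>y\<close>, so membership of \<open>z\<close> there says exactly
      \<open>h z \<le> h y\<close>.\<close>
    obtain r where r: "h y = ereal r"
      using proper_function_ereal[OF assms y] .
    then have mem: "y \<in> sublevel_set r h"
      by (simp add: sublevel_set_def)
    then have "star_shaped_at (sublevel_set r h) xbar"
      using R by blast
    then have "z \<in> sublevel_set r h"
      using mem z by (auto simp: star_shaped_at_def)
    then show ?thesis
      by (simp add: sublevel_set_def r)
  qed
  show ?min
    unfolding mem_argmin_set_iff
  proof
    fix y
    show "h xbar \<le> h y"
      \<comment> \<open>Outside the effective domain \<open>h y = \<infinity>\<close>, and the bound
        is trivial.\<close>
      using seg[of y xbar] by (cases "h y = \<infinity>") (auto simp: effective_domain_def)
  qed
  show ?qc
    unfolding star_quasiconvex_wrt_def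
  proof (intro ballI)
    fix y and t :: real
    assume y: "y \<in> effective_domain h" and t: "t \<in> {0..1}"
    have "t *\<^sub>R xbar + (1 - t) *\<^sub>R y \<in> closed_segment xbar y"
      unfolding closed_segment_commute[of xbar y] using t
      by (auto simp: closed_segment_def add.commute)
    then show "h (t *\<^sub>R xbar + (1 - t) *\<^sub>R y) \<le> h y"
      using seg[OF y] by simp
  qed
qed

end
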